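(* Let $p$ be a prime and let $\mathcal{E}_{\mathrm{st}}$, $\mathcal{E}_{\mathrm{st}}^\dagger$ be the stable Barratt–Eccles chain and cochain operads over $\mathbb{F}_p$. For $n\ge0$, $$\mathrm{H}_\bullet\mathcal{E}_{\mathrm{st}}(n)\cong\begin{cases}0&n\neq1\\ \mathbb{F}_p[0]&n=1\end{cases}\qquad\text{and}\qquad \mathrm{H}^\bullet\mathcal{E}_{\mathrm{st}}^\dagger(n)\cong\begin{cases}0&n\neq1\\ \mathbb{F}_p[0]&n=1.\end{cases}$$
   Context: The ground field is $\mathbb{F}_p$; $\mathbb{F}_p[0]$ is $\mathbb{F}_p$ concentrated in degree $0$. $X[n]_d=X_{d-n}$. For a chain complex $X$, $X^\dagger$ is the cochain complex with $(X^\dagger)^d=X_{-d}$. Let $\mathcal{E}(n)=\mathrm{C}_\bullet(E\Sigma_n;\mathbb{F}_p)$ (normalized chains), i.e. $\mathcal{E}(n)_d$ is spanned by tuples $(\rho_0,\dots,\rho_d)\in\Sigma_n^{d+1}$, tuples with $\rho_i=\rho_{i+1}$ for some $i$ being zero, with $\partial$ the alternating sum of deletions. The operadic suspension of a chain operad $\mathcal{P}$ is $\Sigma\mathcal{P}=\mathcal{P}\otimes\mathcal{E}nd_{\mathbb{F}_p[1]}$, so $(\Sigma^k\mathcal{P})(n)\cong\mathcal{P}(n)[k-kn]$. The stabilization map $\Psi\colon(\Sigma\mathcal{E})(n)\to\mathcal{E}(n)$: for $(\rho_0,\dots,\rho_{d+n-1})\in(\Sigma\mathcal{E})(n)_d=\mathcal{E}(n)_{d+n-1}$,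 put $\Psi(\rho_0,\dots,\rho_{d+n-1})=0$ if $(\rho_0(1),\dots,\rho_{n-1}(1))$ is not a permutation of $(1,\dots,n)$ (or if $d<0$), and otherwise $\Psi(\rho_0,\dots,\rho_{d+n-1})=\pm(\rho_{n-1},\dots,\rho_{d+n-1})$, with $\pm$ the sign of that permutation (for $n=0$ the map is zero). Then $\mathcal{E}_{\mathrm{st}}(n)=\lim(\cdots\xrightarrow{\Sigma^2\Psi}(\Sigma^2\mathcal{E})(n)\xrightarrow{\Sigma\Psi}(\Sigma\mathcal{E})(n)\xrightarrow{\Psi}\mathcal{E}(n))$ and $\mathcal{E}_{\mathrm{st}}^\dagger(n)=\mathcal{E}_{\mathrm{st}}(n)^\dagger$. *)

theory Defs
  imports
    "Berlekamp_Zassenhaus.Finite_Field"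
    "Jordan_Normal_Form.VS_Connect"
    "HOL-Algebra.AbelCoset"
    "HOL-Combinatorics.Permutations"
begin

hide_const (open) Multiset.mult Polynomial.smult Modules.module

text \<open>
  Vector spaces are \<open>HOL-Algebra\<close> modules over \<^term>\<open>class_ring\<close>, the ring of all elements of a
  coefficient type \<open>'k\<close>; in the application \<open>'k\<close> is \<open>'p mod_ring\<close> with \<open>'p :: prime_card\<close>, i.e. the
  field of integers modulo the prime \<open>CARD('p)\<close>. The fields \<open>mult\<close> and \<open>one\<close> that the record type
  of modules inherits from rings carry no meaning.
\<close>

section \<open>Graded modules and complexes\<close>

definition graded_iso ::
    "'r ring \<Rightarrow> (int \<Rightarrow> ('r, 'a) module) \<Rightarrow> (int \<Rightarrow> ('r, 'b) module) \<Rightarrow> bool" where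
  "graded_iso R M N \<longleftrightarrow>
    (\<forall>d. \<exists>f \<in> module_hom R (M d) (N d). bij_betw f (carrier (M d)) (carrier (N d)))"

definition regular_module :: "('k::comm_ring_1, 'k) module" where
  "regular_module =
    \<lparr>carrier = UNIV, mult = (*), one = 1, zero = 0, add = (+), smult = (*)\<rparr>"

definition zero_module :: "('k::comm_ring_1, 'k) module" where
  "zero_module = regular_module\<lparr>carrier := {0}\<rparr>"

definition zero_graded :: "int \<Rightarrow> ('k::comm_ring_1, 'k) module" where
  "zero_graded = (\<lambda>d. zero_module)"

text \<open>The graded module \<open>k[0]\<close>.\<close>

definition ground_graded :: "int \<Rightarrow> ('k::comm_ring_1, 'k) module" where
  "ground_graded = (\<lambda>d. if d = 0 then regular_module else zero_module)"

text \<open>The quotient \<open>Z / B\<close> for submodules \<open>B \<subseteq> Z\<close> of \<open>M\<close>. Scaling a coset adds \<open>B\<close> back so that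
  \<open>c (z + B) = c z + B\<close> also for \<open>c = 0\<close>.\<close>

definition subquotient :: "('r, 'a) module \<Rightarrow> 'a set \<Rightarrow> 'a set \<Rightarrow> ('r, 'a set) module" where
  "subquotient M Z B =
    \<lparr>carrier = (\<lambda>z. B +>\<^bsub>M\<^esub> z) ` Z, mult = (\<lambda>_ _. undefined), one = undefined,
     zero = B, add = set_add M, smult = (\<lambda>c A. B <+>\<^bsub>M\<^esub> ((\<lambda>a. c \<odot>\<^bsub>M\<^esub> a) ` A))\<rparr>"

text \<open>\<open>bdry X d\<close> is the differential from degree \<open>d\<close> to degree \<open>d - 1\<close>, and \<open>cobdry Y d\<close> the one
  from degree \<open>d\<close> to degree \<open>d + 1\<close>.\<close>

record ('r, 'a) chain_complex =
  chain_space :: "int \<Rightarrow> ('r, 'a) module"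
  bdry :: "int \<Rightarrow> 'a \<Rightarrow> 'a"

record ('r, 'a) cochain_complex =
  cochain_space :: "int \<Rightarrow> ('r, 'a) module"
  cobdry :: "int \<Rightarrow> 'a \<Rightarrow> 'a"

definition homology :: "('r, 'a) chain_complex \<Rightarrow> int \<Rightarrow> ('r, 'a set) module" where
  "homology X d = subquotient (chain_space X d)
    {z \<in> carrier (chain_space X d). bdry X d z = \<zero>\<^bsub>chain_space X (d - 1)\<^esub>}
    (bdry X (d + 1) ` carrier (chain_space X (d + 1)))"

definition cohomology :: "('r, 'a) cochain_complex \<Rightarrow> int \<Rightarrow> ('r, 'a set) module" where
  "cohomology Y d = subquotient (cochain_space Y d)
    {z \<in> carrier (cochain_space Y d). cobdry Y d z = \<zero>\<^bsub>cochain_space Y (d + 1)\<^esub>}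
    (cobdry Y (d - 1) ` carrier (cochain_space Y (d - 1)))"

definition dagger :: "('r, 'a) chain_complex \<Rightarrow> ('r, 'a) cochain_complex" where
  "dagger X =
    \<lparr>cochain_space = (\<lambda>d. chain_space X (- d)), cobdry = (\<lambda>d. bdry X (- d))\<rparr>"

text \<open>\<open>X[m]\<close>, with the usual sign \<open>(-1)\<^sup>m\<close> in the differential. With this sign the stabilization
  map below commutes with the differentials.\<close>

definition shift :: "int \<Rightarrow> ('r::ring_1, 'a) chain_complex \<Rightarrow> ('r, 'a) chain_complex" where
  "shift m X =
    \<lparr>chain_space = (\<lambda>d. chain_space X (d - m)),
     bdry = (\<lambda>d x. (if even m then 1 else - 1) \<odot>\<^bsub>chain_space X (d - m - 1)\<^esub> bdry X (d - m) x)\<rparr>"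

text \<open>The limit of a tower \<open>\<dots> \<rightarrow> X 2 \<rightarrow> X 1 \<rightarrow> X 0\<close> whose map \<open>X (Suc k) \<rightarrow> X k\<close> is \<open>\<phi> k d\<close> in
  degree \<open>d\<close>.\<close>

definition tower_limit ::
    "(nat \<Rightarrow> ('r, 'a) chain_complex) \<Rightarrow> (nat \<Rightarrow> int \<Rightarrow> 'a \<Rightarrow> 'a) \<Rightarrow> ('r, nat \<Rightarrow> 'a) chain_complex" where
  "tower_limit X \<phi> =
    \<lparr>chain_space = (\<lambda>d.
       \<lparr>carrier = {x. \<forall>k. x k \<in> carrier (chain_space (X k) d) \<and> \<phi> k d (x (Suc k)) = x k},
        mult = (\<lambda>_ _. undefined), one = undefined,
        zero = (\<lambda>k. \<zero>\<^bsub>chain_space (X k) d\<^esub>),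
        add = (\<lambda>x y k. x k \<oplus>\<^bsub>chain_space (X k) d\<^esub> y k),
        smult = (\<lambda>c x k. c \<odot>\<^bsub>chain_space (X k) d\<^esub> x k)\<rparr>),
     bdry = (\<lambda>d x k. bdry (X k) d (x k))\<rparr>"

section \<open>The Barratt--Eccles complexes\<close>

type_synonym perm_tuple = "(nat \<Rightarrow> nat) list"

definition nondeg_tuples :: "nat \<Rightarrow> int \<Rightarrow> perm_tuple set" where
  "nondeg_tuples n d =
    {\<sigma>. d \<ge> 0 \<and> int (length \<sigma>) = d + 1 \<and> (\<forall>\<rho> \<in> set \<sigma>. \<rho> permutes {1..n}) \<and> distinct_adj \<sigma>}"

text \<open>The linear map from the span of the finite set \<open>S\<close> to the span of \<open>T\<close> that sends \<open>\<sigma> \<in> S\<close> to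
  the combination with coefficients \<open>A \<sigma>\<close>; coefficients at tuples outside \<open>T\<close> are dropped, so that
  degenerate tuples count as zero.\<close>

definition linear_extension ::
    "'s set \<Rightarrow> 's set \<Rightarrow> ('s \<Rightarrow> 's \<Rightarrow> 'k::comm_ring_1) \<Rightarrow> ('s \<Rightarrow> 'k) \<Rightarrow> ('s \<Rightarrow> 'k)" where
  "linear_extension S T A f = (\<lambda>\<tau>\<in>T. \<Sum>\<sigma>\<in>S. f \<sigma> * A \<sigma> \<tau>)"

definition delete_at :: "nat \<Rightarrow> 's list \<Rightarrow> 's list" where
  "delete_at i \<sigma> = take i \<sigma> @ drop (Suc i) \<sigma>"

definition barratt_eccles :: "nat \<Rightarrow> ('k::comm_ring_1, perm_tuple \<Rightarrow> 'k) chain_complex" where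
  "barratt_eccles n =
    \<lparr>chain_space = (\<lambda>d. ring.func_space class_ring (nondeg_tuples n d)),
     bdry = (\<lambda>d. linear_extension (nondeg_tuples n d) (nondeg_tuples n (d - 1))
       (\<lambda>\<sigma> \<tau>. \<Sum>i<length \<sigma>. (- 1) ^ i * of_bool (delete_at i \<sigma> = \<tau>)))\<rparr>"

text \<open>The arity \<open>n\<close> component of the \<open>k\<close>-fold operadic suspension, up to the identification
  of \<open>P(n) \<otimes> End(n)\<close> with a shift of \<open>P(n)\<close>.\<close>

definition operadic_suspension ::
    "nat \<Rightarrow> nat \<Rightarrow> ('r::ring_1, 'a) chain_complex \<Rightarrow> ('r, 'a) chain_complex" where
  "operadic_suspension k n X = shift (int k - int k * int n) X"

text \<open>\<open>leading_values n [\<rho>\<^sub>0, \<rho>\<^sub>1, \<dots>]\<close> is the map \<open>i \<mapsto> \<rho>\<^bsub>i-1\<^esub>(1)\<close> on \<open>{1..n}\<close>, extended by the identity.\<close>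

definition leading_values :: "nat \<Rightarrow> perm_tuple \<Rightarrow> nat \<Rightarrow> nat" where
  "leading_values n \<sigma> i = (if i \<in> {1..n} then (\<sigma> ! (i - 1)) 1 else i)"

definition stabilization_sign :: "nat \<Rightarrow> perm_tuple \<Rightarrow> int" where
  "stabilization_sign n \<sigma> =
    (if n > 0 \<and> leading_values n \<sigma> permutes {1..n} then sign (leading_values n \<sigma>) else 0)"

text \<open>\<open>stabilization n d\<close> is the degree \<open>d\<close> component of \<open>\<Psi>\<close>, from \<open>E(n)\<close> in degree \<open>d + n - 1\<close> to
  \<open>E(n)\<close> in degree \<open>d\<close>. It vanishes for \<open>d < 0\<close> since then \<open>nondeg_tuples n d\<close> is empty.\<close>

definition stabilization ::
    "nat \<Rightarrow> int \<Rightarrow> (perm_tuple \<Rightarrow> 'k::comm_ring_1) \<Rightarrow> (perm_tuple \<Rightarrow> 'k)" where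
  "stabilization n d =
    linear_extension (nondeg_tuples n (d + int n - 1)) (nondeg_tuples n d)
      (\<lambda>\<sigma> \<tau>. of_int (stabilization_sign n \<sigma>) * of_bool (drop (n - 1) \<sigma> = \<tau>))"

text \<open>The \<open>k\<close>-th map of the tower is \<open>\<Psi>\<close> shifted by \<open>k - k n\<close>.\<close>

definition stable_barratt_eccles ::
    "nat \<Rightarrow> ('k::comm_ring_1, nat \<Rightarrow> perm_tuple \<Rightarrow> 'k) chain_complex" where
  "stable_barratt_eccles n =
    tower_limit (\<lambda>k. operadic_suspension k n (barratt_eccles n))
      (\<lambda>k d. stabilization n (d - (int k - int k * int n)))"

definition stable_barratt_eccles_dagger ::
    "nat \<Rightarrow> ('k::comm_ring_1, nat \<Rightarrow> perm_tuple \<Rightarrow> 'k) cochain_complex" where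
  "stable_barratt_eccles_dagger n = dagger (stable_barratt_eccles n)"

end

theory Submission
  imports Defs
begin

text \<open>
  For \<open>n \<ge> 2\<close> the homology of the \<open>k\<close>-th level of the tower sits in degree \<open>k - k n\<close>, so in a fixed
  degree all but finitely many levels are acyclic. The primitives of a cycle in the limit thus form
  an inverse system of sets which are nonempty at all high levels, hence at all levels. They are
  finite because the coefficients are, so the system has a point and no \<open>lim\<^sup>1\<close> obstruction occurs.
  For \<open>n = 0\<close> the limit vanishes, and for \<open>n = 1\<close> the tower is constant.

  That \<open>\<Psi>\<close> commutes with the differentials comes down to the vanishing of the alternating sum of the
  signs of the sequences obtained by deleting one entry of \<open>a\<^sub>0, \<dots>, a\<^sub>n \<in> {1, \<dots>, n}\<close>: two entries
  \<open>a\<^sub>r = a\<^sub>s\<close> agree, only the deletions of \<open>a\<^sub>r\<close> and \<open>a\<^sub>s\<close> can give permutations, and these two differ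
  by a cycle of length \<open>s - r\<close>.
\<close>

section \<open>Inverse limits of finite sets\<close>

text \<open>A member of least cardinality lies in all the others: in earlier ones by monotonicity,
  and in later ones because a subset of at least the same cardinality is the whole set.\<close>

lemma decreasing_finite_Inter_nonempty:
  fixes A :: "nat \<Rightarrow> 'a set"
  assumes fin: "\<And>m. finite (A m)" and ne: "\<And>m. A m \<noteq> {}" and dec: "\<And>m. A (Suc m) \<subseteq> A m"
  shows "(\<Inter>m. A m) \<noteq> {}"
proof -
  obtain m where m: "\<And>k. card (A m) \<le> card (A k)"
    using exists_least_iff[of "\<lambda>c. \<exists>m. card (A m) = c"] by (metis not_less)
  have "A m \<subseteq> A k" for k
  proof (cases "k \<le> m")
    case True
    then show ?thesis using lift_Suc_antimono_le[of A, OF dec] by blast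
  next
    case False
    then have "A k \<subseteq> A m" using lift_Suc_antimono_le[of A m k, OF dec] by simp
    with m[of k] fin show ?thesis by (metis card_seteq subset_refl)
  qed
  with ne[of m] show ?thesis by blast
qed

text \<open>Passing to the elements that lift to every higher level makes the maps surjective, after
  which a point of the limit is built upwards by dependent choice.\<close>

lemma inverse_limit_finite_nonempty:
  fixes S :: "nat \<Rightarrow> 'a set" and f :: "nat \<Rightarrow> 'a \<Rightarrow> 'a"
  assumes fin: "\<And>k. finite (S k)" and ne: "\<And>k. S k \<noteq> {}"
    and maps: "\<And>k y. y \<in> S (Suc k) \<Longrightarrow> f k y \<in> S k"
  shows "\<exists>x. \<forall>k. x k \<in> S k \<and> f k (x (Suc k)) = x k"
proof -
  \<comment> \<open>\<open>I m k\<close> is the image of \<open>S (k + m)\<close> in level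
    \<open>k\<close>. The recursion produces all levels at once, since stage \<open>Suc m\<close> at
    level \<open>k\<close> needs stage \<open>m\<close> at level \<open>Suc k\<close>.\<close>
  define I where "I m = rec_nat S (\<lambda>_ J k. f k ` J (Suc k)) m" for m
  have I0: "I 0 k = S k" and IS: "I (Suc m) k = f k ` I m (Suc k)" for m k
    by (simp_all add: I_def)
  have fin_I: "finite (I m k)" and ne_I: "I m k \<noteq> {}" for m k
    by (induction m arbitrary: k) (auto simp: I0 IS fin ne)
  have dec: "I (Suc m) k \<subseteq> I m k" for m k
    by (induction m arbitrary: k) (use maps in \<open>force simp: I0 IS\<close>)+
  define G where "G k = (\<Inter>m. I m k)" for k
  have G_ne: "G k \<noteq> {}" for k
    unfolding G_def by (rule decreasing_finite_Inter_nonempty) (use fin_I ne_I dec in auto)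
  \<comment> \<open>The preimages of \<open>x\<close> inside the sets \<open>I m (Suc k)\<close>
    decrease with \<open>m\<close> and are finite and nonempty, so the intersection lemma applies to
    them as well.\<close>
  have G_lift: "\<exists>y \<in> G (Suc k). f k y = x" if "x \<in> G k" for k x
  proof -
    have "x \<in> I (Suc m) k" for m
      using that by (auto simp: G_def)
    then have "{y \<in> I m (Suc k). f k y = x} \<noteq> {}" for m
      by (auto simp: IS)
    then have "(\<Inter>m. {y \<in> I m (Suc k). f k y = x}) \<noteq> {}"
      by (intro decreasing_finite_Inter_nonempty) (auto simp: fin_I dest: subsetD[OF dec])
    then show ?thesis by (auto simp: G_def)
  qed
  have "\<exists>x. \<forall>k. x k \<in> G k \<and> f k (x (Suc k)) = x k"
    by (rule dependent_nat_choice) (use G_ne G_lift in blast)+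
  moreover have "G k \<subseteq> S k" for k
    unfolding G_def using I0 by blast
  ultimately show ?thesis by blast
qed

section \<open>Signs of sequences\<close>

text \<open>The Levi-Civita symbol of \<open>a 0, ..., a (n - 1)\<close>. The shift by one arises
  because sequences are indexed from 0 while the permutations act on \<open>{1..n}\<close>.\<close>

definition sequence_sign :: "nat \<Rightarrow> (nat \<Rightarrow> nat) \<Rightarrow> int" where
  "sequence_sign n a = (let p = \<lambda>i. if i \<in> {1..n} then a (i - 1) else i
     in if p permutes {1..n} then sign p else 0)"

text \<open>The coface map whose image omits \<open>i\<close>: the sequence
  \<open>a \<circ> skip i\<close> is \<open>a\<close> with its entry at \<open>i\<close>
  deleted.\<close>

definition skip :: "nat \<Rightarrow> nat \<Rightarrow> nat" where
  "skip i j = (if j < i then j else Suc j)"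

lemma sequence_sign_cong:
  assumes "\<And>i. i < n \<Longrightarrow> a i = b i"
  shows "sequence_sign n a = sequence_sign n b"
proof -
  have "(\<lambda>i. if i \<in> {1..n} then a (i - 1) else i) = (\<lambda>i. if i \<in> {1..n} then b (i - 1) else i)"
    using assms by (auto simp: fun_eq_iff)
  then show ?thesis by (simp add: sequence_sign_def)
qed

lemma sequence_sign_eq_0:
  assumes "a i = a j" "i < j" "j < n"
  shows "sequence_sign n a = 0"
proof -
  let ?p = "\<lambda>i. if i \<in> {1..n} then a (i - 1) else i"
  have "\<not> ?p permutes {1..n}"
  proof
    assume "?p permutes {1..n}"
    then have "inj ?p" by (rule permutes_inj)
    moreover have "?p (Suc i) = ?p (Suc j)" using assms by simp
    ultimately have "Suc i = Suc j" by (rule injD)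
    with assms(2) show False by simp
  qed
  then show ?thesis by (simp add: sequence_sign_def)
qed

lemma sequence_sign_transpose:
  assumes "Suc j < n"
  shows "sequence_sign n (a \<circ> transpose j (Suc j)) = - sequence_sign n a"
proof -
  let ?p = "\<lambda>a i. if i \<in> {1..n} then a (i - 1) else i"
  let ?t = "transpose (Suc j) (Suc (Suc j))"
  have t: "?t permutes {1..n}" using assms by (intro permutes_swap_id) auto
  have eq: "?p (a \<circ> transpose j (Suc j)) = ?p a \<circ> ?t" for a
    using assms by (fastforce simp: transpose_def fun_eq_iff)
  \<comment> \<open>Composing with the involution \<open>?t\<close> once more recovers
    \<open>?p a\<close>, so both sides of the claim take the default value 0 simultaneously.\<close>
  have "?p a permutes {1..n}" if "?p a \<circ> ?t permutes {1..n}"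
    using permutes_compose[OF t that] by (simp add: comp_assoc)
  then have iff: "?p a \<circ> ?t permutes {1..n} \<longleftrightarrow> ?p a permutes {1..n}"
    using permutes_compose[OF t] by blast
  have "sign (?p a \<circ> ?t) = - sign (?p a)" if "?p a permutes {1..n}"
    using that t by (subst sign_compose) (simp_all add: sign_swap_id permutes_imp_permutation[OF finite_atLeastAtMost])
  with iff show ?thesis unfolding sequence_sign_def eq by simp
qed

text \<open>The two sequences differ only in the place of the common value: index \<open>r\<close>
  if \<open>a s\<close> is deleted, index \<open>s - 1\<close> if \<open>a r\<close> is. Moving it
  from one to the other takes \<open>s - r - 1\<close> adjacent swaps.\<close>

lemma sequence_sign_skip:
  assumes "r < s" "s \<le> n" "a r = a s"
  shows "sequence_sign n (a \<circ> skip s) = (- 1) ^ (s - Suc r) * sequence_sign n (a \<circ> skip r)"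
proof -
  have "sequence_sign n (a \<circ> skip (Suc r + m)) = (- 1) ^ m * sequence_sign n (a \<circ> skip r)"
    if "Suc r + m \<le> n" "a r = a (Suc r + m)" for m
    using that
  proof (induction m arbitrary: a)
    case 0
    then show ?case by (auto intro!: sequence_sign_cong simp: skip_def less_Suc_eq)
  next
    case (Suc m)
    let ?s = "Suc r + m"
    \<comment> \<open>Swapping the later copy with its left neighbour narrows the gap by one.
      Deleting that copy from \<open>b\<close> or from \<open>a\<close> leaves the same sequence,
      while deleting \<open>r\<close> leaves sequences that differ by one adjacent swap.\<close>
    define b where "b = a \<circ> transpose ?s (Suc ?s)"
    have "sequence_sign n (a \<circ> skip (Suc ?s)) = sequence_sign n (b \<circ> skip ?s)"
      by (rule sequence_sign_cong) (auto simp: b_def skip_def transpose_def)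
    also have "\<dots> = (- 1) ^ m * sequence_sign n (b \<circ> skip r)"
      using Suc.prems by (intro Suc.IH) (auto simp: b_def transpose_def)
    also have "b \<circ> skip r = (a \<circ> skip r) \<circ> transpose (r + m) (Suc (r + m))"
      by (auto simp: b_def skip_def transpose_def fun_eq_iff)
    also have "sequence_sign n \<dots> = - sequence_sign n (a \<circ> skip r)"
      using Suc.prems by (intro sequence_sign_transpose) auto
    finally show ?case by (simp del: comp_apply)
  qed
  from this[of "s - Suc r"] assms show ?thesis by simp
qed

lemma alternating_sum_sequence_sign:
  assumes range: "\<And>i. i \<le> n \<Longrightarrow> a i \<in> {1..n}"
  shows "(\<Sum>i\<le>n. (- 1) ^ i * sequence_sign n (a \<circ> skip i)) = 0"
proof -
  \<comment> \<open>Pigeonhole: \<open>n + 1\<close> indices have values in a set of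
    \<open>n\<close> elements.\<close>
  have "a ` {..n} \<subseteq> {1..n}" using range by blast
  then have "card (a ` {..n}) \<le> n" using card_mono[of "{1..n}"] by fastforce
  then have "\<not> inj_on a {..n}" using card_image[of a "{..n}"] by fastforce
  then obtain i j where "i \<le> n" "j \<le> n" "a i = a j" "i \<noteq> j"
    unfolding inj_on_def by blast
  then obtain r s where rs: "r < s" "s \<le> n" "a r = a s"
    by (metis linorder_neqE_nat)
  have "sequence_sign n (a \<circ> skip i) = 0" if "i \<noteq> r" "i \<noteq> s" "i \<le> n" for i
  proof -
    \<comment> \<open>\<open>?q\<close> is the index of an entry after deletion of entry
      \<open>i\<close>. Both copies of the repeated value survive this deletion, so its sign is
      0.\<close>
    let ?q = "\<lambda>j. if j < i then j else j - 1"
    have "skip i (?q r) = r" "skip i (?q s) = s" using that by (auto simp: skip_def)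
    moreover have "?q r < ?q s" "?q s < n" using that rs by auto
    ultimately show ?thesis using rs(3) by (intro sequence_sign_eq_0[of _ "?q r" "?q s"]) auto
  qed
  then have "(\<Sum>i\<le>n. (- 1) ^ i * sequence_sign n (a \<circ> skip i))
      = (\<Sum>i\<in>{r, s}. (- 1) ^ i * sequence_sign n (a \<circ> skip i))"
    using rs by (intro sum.mono_neutral_right) auto
  also have "\<dots> = 0"
  proof -
    define m where "m = s - Suc r"
    have s: "s = Suc r + m" using rs(1) by (simp add: m_def)
    \<comment> \<open>As \<open>s + m = r + 1 + 2 m\<close>, the two remaining terms have opposite
      signs.\<close>
    have "(- 1 :: int) ^ m * (- 1) ^ m = 1" by (simp flip: power_mult_distrib)
    then have "(- 1 :: int) ^ s * (- 1) ^ m = - ((- 1) ^ r)"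
      by (simp add: s power_add)
    then have "(- 1) ^ s * sequence_sign n (a \<circ> skip s) = - ((- 1) ^ r * sequence_sign n (a \<circ> skip r))"
      unfolding sequence_sign_skip[OF rs] m_def[symmetric] mult.assoc[symmetric] by simp
    then show ?thesis using rs(1) by simp
  qed
  finally show ?thesis .
qed

section \<open>The Barratt--Eccles complexes\<close>

lemma linear_extension_apply:
  "\<tau> \<in> T \<Longrightarrow> linear_extension S T A f \<tau> = (\<Sum>\<sigma>\<in>S. f \<sigma> * A \<sigma> \<tau>)"
  by (simp add: linear_extension_def)

lemma linear_extension_in: "linear_extension S T A f \<in> T \<rightarrow>\<^sub>E UNIV"
  by (simp add: linear_extension_def)

lemma linear_extension_eqI:
  assumes "\<And>\<tau>. \<tau> \<in> T \<Longrightarrow> (\<Sum>\<sigma>\<in>S. f \<sigma> * A \<sigma> \<tau>) = g \<tau>" "g \<in> T \<rightarrow>\<^sub>E UNIV"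
  shows "linear_extension S T A f = g"
  using assms by (auto simp: linear_extension_def fun_eq_iff PiE_def extensional_def)

text \<open>With \<open>b\<close> a column of a second coefficient matrix, this is the associativity
  of matrix products. It reduces statements about composites of linear maps to identities between
  coefficients.\<close>

lemma sum_linear_extension:
  assumes "finite S" "finite T"
  shows "(\<Sum>\<tau>\<in>T. linear_extension S T A f \<tau> * b \<tau>) = (\<Sum>\<sigma>\<in>S. f \<sigma> * (\<Sum>\<tau>\<in>T. A \<sigma> \<tau> * b \<tau>))"
proof -
  have "(\<Sum>\<tau>\<in>T. linear_extension S T A f \<tau> * b \<tau>) = (\<Sum>\<tau>\<in>T. \<Sum>\<sigma>\<in>S. f \<sigma> * (A \<sigma> \<tau> * b \<tau>))"
    by (intro sum.cong) (simp_all add: linear_extension_apply sum_distrib_right mult.assoc)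
  also have "\<dots> = (\<Sum>\<sigma>\<in>S. \<Sum>\<tau>\<in>T. f \<sigma> * (A \<sigma> \<tau> * b \<tau>))"
    by (rule sum.swap)
  finally show ?thesis by (simp add: sum_distrib_left)
qed

lemma linear_extension_add:
  "linear_extension S T A (\<lambda>v\<in>S. f v + g v) =
    (\<lambda>v\<in>T. linear_extension S T A f v + linear_extension S T A g v)"
  by (rule linear_extension_eqI) (simp_all add: linear_extension_apply ring_distribs sum.distrib)

lemma linear_extension_scale:
  "linear_extension S T A (\<lambda>v\<in>S. c * f v) = (\<lambda>v\<in>T. c * linear_extension S T A f v)"
  by (rule linear_extension_eqI) (simp_all add: linear_extension_apply sum_distrib_left mult.assoc)

section \<open>Faces of nondegenerate tuples and acyclicity in positive degrees\<close>

lemma finite_nondeg_tuples: "finite (nondeg_tuples n d)"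
proof (rule finite_subset)
  show "nondeg_tuples n d \<subseteq> {\<sigma>. set \<sigma> \<subseteq> {\<rho>. \<rho> permutes {1..n}} \<and> length \<sigma> = nat (d + 1)}"
    by (auto simp: nondeg_tuples_def)
  show "finite {\<sigma>. set \<sigma> \<subseteq> {\<rho>. \<rho> permutes {1..n}} \<and> length \<sigma> = nat (d + 1)}"
    by (rule finite_lists_length_eq) (rule finite_permutations, simp)
qed

definition face_sum :: "'s list \<Rightarrow> 's list \<Rightarrow> 'k::comm_ring_1" where
  "face_sum \<sigma> \<tau> = (\<Sum>i<length \<sigma>. (- 1) ^ i * of_bool (delete_at i \<sigma> = \<tau>))"

lemma bdry_barratt_eccles:
  "bdry (barratt_eccles n) d =
    linear_extension (nondeg_tuples n d) (nondeg_tuples n (d - 1)) face_sum"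
  by (simp add: barratt_eccles_def face_sum_def[abs_def])

lemma length_delete_at: "i < length \<sigma> \<Longrightarrow> length (delete_at i \<sigma>) = length \<sigma> - 1"
  by (simp add: delete_at_def)

lemma set_delete_at: "set (delete_at i \<sigma>) \<subseteq> set \<sigma>"
  using set_take_subset[of i \<sigma>] set_drop_subset[of "Suc i" \<sigma>] by (auto simp: delete_at_def)

lemma delete_at_0: "delete_at 0 \<sigma> = tl \<sigma>"
  by (simp add: delete_at_def drop_Suc)

lemma delete_at_Suc_Cons: "delete_at (Suc i) (\<rho> # \<sigma>) = \<rho> # delete_at i \<sigma>"
  by (simp add: delete_at_def)

lemma nth_delete_at: "i < length \<sigma> \<Longrightarrow> Suc j < length \<sigma> \<Longrightarrow> delete_at i \<sigma> ! j = \<sigma> ! skip i j"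
  by (auto simp: delete_at_def skip_def nth_append)

lemma drop_delete_at_less: "i < Suc m \<Longrightarrow> i < length \<sigma> \<Longrightarrow> drop m (delete_at i \<sigma>) = drop (Suc m) \<sigma>"
  by (auto simp: delete_at_def)

lemma drop_delete_at_ge: "m + j < length \<sigma> \<Longrightarrow> drop m (delete_at (m + j) \<sigma>) = delete_at j (drop m \<sigma>)"
  by (simp add: delete_at_def drop_take add.commute)

text \<open>Interchanging the sums leaves one term per deleted position. With \<open>T\<close> the
  nondegenerate tuples, the membership test is where degenerate faces become zero.\<close>

lemma sum_face_sum:
  assumes "finite T"
  shows "(\<Sum>\<tau>\<in>T. face_sum \<sigma> \<tau> * b \<tau>) =
    (\<Sum>i<length \<sigma>. (- 1) ^ i * (if delete_at i \<sigma> \<in> T then b (delete_at i \<sigma>) else 0))"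
proof -
  have "(\<Sum>\<tau>\<in>T. face_sum \<sigma> \<tau> * b \<tau>) =
      (\<Sum>\<tau>\<in>T. \<Sum>i<length \<sigma>. (- 1) ^ i * (if \<tau> = delete_at i \<sigma> then b \<tau> else 0))"
    unfolding face_sum_def sum_distrib_right by (intro sum.cong refl) auto
  also have "\<dots> = (\<Sum>i<length \<sigma>. \<Sum>\<tau>\<in>T. (- 1) ^ i * (if \<tau> = delete_at i \<sigma> then b \<tau> else 0))"
    by (rule sum.swap)
  finally show ?thesis using assms by (simp flip: sum_distrib_left)
qed

text \<open>Prepending the identity is a contracting homotopy in positive degrees.\<close>

lemma prepend_id_homotopy:
  assumes d: "d > 0" and \<sigma>: "\<sigma> \<in> nondeg_tuples n d" and \<upsilon>: "\<upsilon> \<in> nondeg_tuples n d"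
  shows "(\<Sum>\<tau>\<in>nondeg_tuples n (d + 1). of_bool (id # \<sigma> = \<tau>) * face_sum \<tau> \<upsilon>) +
     (\<Sum>\<tau>\<in>nondeg_tuples n (d - 1). face_sum \<sigma> \<tau> * of_bool (id # \<tau> = \<upsilon>)) =
     (of_bool (\<sigma> = \<upsilon>) :: 'k::comm_ring_1)"
proof -
  let ?P = "\<Sum>i<length \<sigma>. (- 1) ^ i * of_bool (id # delete_at i \<sigma> = \<upsilon>) :: 'k"
  have len: "int (length \<sigma>) = d + 1" "int (length \<upsilon>) = d + 1"
    using \<sigma> \<upsilon> by (auto simp: nondeg_tuples_def)
  \<comment> \<open>A face that becomes \<upsilon> when the identity is prepended is nondegenerate
    because \<upsilon> is. The assumption \<open>d > 0\<close> keeps it from being the empty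
    list.\<close>
  have "delete_at i \<sigma> \<in> nondeg_tuples n (d - 1)" if "i < length \<sigma>" "id # delete_at i \<sigma> = \<upsilon>" for i
  proof -
    have "distinct_adj (delete_at i \<sigma>)"
      using \<upsilon> that(2) distinct_adj_ConsD by (auto simp: nondeg_tuples_def)
    moreover have "\<forall>\<rho>\<in>set (delete_at i \<sigma>). \<rho> permutes {1..n}"
      using \<sigma> set_delete_at[of i \<sigma>] by (auto simp: nondeg_tuples_def)
    ultimately show ?thesis
      using d len that by (auto simp: nondeg_tuples_def length_delete_at)
  qed
  then have "(\<Sum>\<tau>\<in>nondeg_tuples n (d - 1). face_sum \<sigma> \<tau> * of_bool (id # \<tau> = \<upsilon>)) = ?P"
    unfolding sum_face_sum[OF finite_nondeg_tuples] by (intro sum.cong) auto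
  moreover have "(\<Sum>\<tau>\<in>nondeg_tuples n (d + 1). of_bool (id # \<sigma> = \<tau>) * face_sum \<tau> \<upsilon>) =
      of_bool (\<sigma> = \<upsilon>) - ?P"
  proof (cases "id # \<sigma> \<in> nondeg_tuples n (d + 1)")
    case True
    have "(\<Sum>\<tau>\<in>nondeg_tuples n (d + 1). of_bool (id # \<sigma> = \<tau>) * face_sum \<tau> \<upsilon>) =
        (\<Sum>\<tau>\<in>nondeg_tuples n (d + 1). if id # \<sigma> = \<tau> then face_sum \<tau> \<upsilon> else 0 :: 'k)"
      by (intro sum.cong) auto
    also have "\<dots> = face_sum (id # \<sigma>) \<upsilon>"
      using True by (simp add: finite_nondeg_tuples)
    \<comment> \<open>Face 0 of \<open>id # \<sigma>\<close> is \<sigma>; every other face prepends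
      the identity to a face of \<sigma>, with its index raised by one and hence its sign
      reversed.\<close>
    also have "\<dots> = of_bool (\<sigma> = \<upsilon>) - ?P"
      unfolding face_sum_def list.size add_Suc_right add_0_right sum.lessThan_Suc_shift
      by (simp add: delete_at_0 delete_at_Suc_Cons sum_negf)
    finally show ?thesis .
  next
    case False
    \<comment> \<open>Here prepending gives a degenerate tuple, so \<sigma> already starts with the
      identity. Only deleting this first entry can contribute to \<open>?P\<close>; any other
      deletion would make \<upsilon> start with two identities.\<close>
    obtain \<sigma>' where \<sigma>': "\<sigma> = id # \<sigma>'"
      using False \<sigma> d by (cases \<sigma>) (auto simp: nondeg_tuples_def)
    have "id # delete_at (Suc i) \<sigma> \<noteq> \<upsilon>" for i
    proof
      assume "id # delete_at (Suc i) \<sigma> = \<upsilon>"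
      then show False using \<upsilon> by (auto simp: \<sigma>' delete_at_Suc_Cons nondeg_tuples_def)
    qed
    then have "?P = of_bool (\<sigma> = \<upsilon>)"
      by (simp add: \<sigma>' sum.lessThan_Suc_shift delete_at_0 del: sum.lessThan_Suc)
    moreover have "(\<Sum>\<tau>\<in>nondeg_tuples n (d + 1). of_bool (id # \<sigma> = \<tau>) * face_sum \<tau> \<upsilon>) = (0::'k)"
      using False by (intro sum.neutral) auto
    ultimately show ?thesis by simp
  qed
  ultimately show ?thesis by simp
qed

text \<open>If \<open>h\<close> prepends the identity, then the boundary of \<open>h z\<close> is
  \<open>z\<close> minus \<open>h\<close> of the boundary of \<open>z\<close>, which is
  \<open>z\<close> for a cycle.\<close>

lemma barratt_eccles_acyclic:
  fixes z :: "perm_tuple \<Rightarrow> 'k::comm_ring_1"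
  assumes d: "d > 0" and z: "z \<in> nondeg_tuples n d \<rightarrow>\<^sub>E UNIV"
    and cycle: "bdry (barratt_eccles n) d z = (\<lambda>v\<in>nondeg_tuples n (d - 1). 0)"
  obtains y where "y \<in> nondeg_tuples n (d + 1) \<rightarrow>\<^sub>E UNIV" "bdry (barratt_eccles n) (d + 1) y = z"
proof
  define y where "y = linear_extension (nondeg_tuples n d) (nondeg_tuples n (d + 1))
    (\<lambda>\<sigma> \<tau>. of_bool (id # \<sigma> = \<tau>)) z"
  show "y \<in> nondeg_tuples n (d + 1) \<rightarrow>\<^sub>E UNIV"
    unfolding y_def by (rule linear_extension_in)
  show "bdry (barratt_eccles n) (d + 1) y = z"
    unfolding bdry_barratt_eccles
  proof (rule linear_extension_eqI)
    fix \<upsilon> assume "\<upsilon> \<in> nondeg_tuples n (d + 1 - 1)"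
    then have \<upsilon>: "\<upsilon> \<in> nondeg_tuples n d" by simp
    \<comment> \<open>\<open>?Q \<sigma>\<close> is the coefficient at \<upsilon> of
      \<open>h\<close> applied to the boundary of \<sigma>; weighted by the cycle \<open>z\<close>,
      these add up to zero.\<close>
    let ?Q = "\<lambda>\<sigma>. \<Sum>\<tau>\<in>nondeg_tuples n (d - 1). face_sum \<sigma> \<tau> * of_bool (id # \<tau> = \<upsilon>) :: 'k"
    have "(\<Sum>\<sigma>\<in>nondeg_tuples n d. z \<sigma> * ?Q \<sigma>) =
        (\<Sum>\<tau>\<in>nondeg_tuples n (d - 1). bdry (barratt_eccles n) d z \<tau> * of_bool (id # \<tau> = \<upsilon>))"
      by (simp only: bdry_barratt_eccles sum_linear_extension finite_nondeg_tuples)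
    also have "\<dots> = 0"
      unfolding cycle by simp
    finally have Q: "(\<Sum>\<sigma>\<in>nondeg_tuples n d. z \<sigma> * ?Q \<sigma>) = 0" .
    have "(\<Sum>\<tau>\<in>nondeg_tuples n (d + 1). y \<tau> * face_sum \<tau> \<upsilon>) =
        (\<Sum>\<sigma>\<in>nondeg_tuples n d. z \<sigma> *
          (\<Sum>\<tau>\<in>nondeg_tuples n (d + 1). of_bool (id # \<sigma> = \<tau>) * face_sum \<tau> \<upsilon>))"
      unfolding y_def by (simp only: sum_linear_extension finite_nondeg_tuples)
    also have "\<dots> = (\<Sum>\<sigma>\<in>nondeg_tuples n d. z \<sigma> * of_bool (\<sigma> = \<upsilon>) - z \<sigma> * ?Q \<sigma>)"
      by (rule sum.cong)
        (simp_all add: prepend_id_homotopy[OF d _ \<upsilon>, symmetric] algebra_simps)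
    also have "\<dots> = (\<Sum>\<sigma>\<in>nondeg_tuples n d. if \<sigma> = \<upsilon> then z \<sigma> else 0)"
      unfolding sum_subtractf Q by (simp add: of_bool_def if_distrib cong: if_cong)
    also have "\<dots> = z \<upsilon>"
      using \<upsilon> by (simp add: finite_nondeg_tuples)
    finally show "(\<Sum>\<tau>\<in>nondeg_tuples n (d + 1). y \<tau> * face_sum \<tau> \<upsilon>) = z \<upsilon>" .
  qed (use z in simp)
qed

section \<open>The stabilization map and the differentials\<close>

lemma stabilization_sign_eq_sequence_sign:
  "n > 0 \<Longrightarrow> stabilization_sign n \<sigma> = sequence_sign n (\<lambda>i. (\<sigma> ! i) 1)"
  \<comment> \<open>At \<open>n = 0\<close> the two differ: the empty sequence has sign 1, whereas
    the stabilization sign is set to 0.\<close>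
  by (simp add: stabilization_sign_def sequence_sign_def leading_values_def[abs_def] Let_def del: One_nat_def)

lemma alternating_sum_stabilization_sign:
  assumes "n > 0" and perm: "\<forall>\<rho>\<in>set \<sigma>. \<rho> permutes {1..n}" and len: "n < length \<sigma>"
  shows "(\<Sum>i\<le>n. (- 1) ^ i * stabilization_sign n (delete_at i \<sigma>)) = 0"
proof -
  let ?a = "\<lambda>i. (\<sigma> ! i) 1"
  have "stabilization_sign n (delete_at i \<sigma>) = sequence_sign n (?a \<circ> skip i)" if "i \<le> n" for i
    unfolding stabilization_sign_eq_sequence_sign[OF \<open>n > 0\<close>]
    by (rule sequence_sign_cong) (use that len in \<open>simp add: nth_delete_at\<close>)
  moreover have "?a i \<in> {1..n}" if "i \<le> n" for i
    using perm len that \<open>n > 0\<close> permutes_in_image[of "\<sigma> ! i" "{1..n}" 1] by force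
  ultimately show ?thesis
    using alternating_sum_sequence_sign[of n ?a] by simp
qed

text \<open>A repetition among the first \<open>n\<close> entries repeats a leading value.\<close>

lemma distinct_adj_of_stabilization:
  assumes "n > 0" and sign: "stabilization_sign n \<sigma> \<noteq> 0" and drop: "distinct_adj (drop (n - 1) \<sigma>)"
  shows "distinct_adj \<sigma>"
  unfolding distinct_adj_conv_nth
proof (intro allI impI notI)
  fix i assume i: "Suc i < length \<sigma>" "\<sigma> ! i = \<sigma> ! Suc i"
  show False
  \<comment> \<open>The first \<open>n\<close> entries and the tail from index \<open>n - 1\<close>
    on share one entry, so each pair of neighbours lies within one of the two blocks.\<close>
  proof (cases "Suc i < n")
    case True
    then have "stabilization_sign n \<sigma> = 0"
      unfolding stabilization_sign_eq_sequence_sign[OF \<open>n > 0\<close>]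
      using i by (intro sequence_sign_eq_0[of _ i "Suc i"]) auto
    with sign show False by simp
  next
    case False
    then have "drop (n - 1) \<sigma> ! (i - (n - 1)) = \<sigma> ! i"
        "drop (n - 1) \<sigma> ! Suc (i - (n - 1)) = \<sigma> ! Suc i"
        "Suc (i - (n - 1)) < length (drop (n - 1) \<sigma>)"
      using i \<open>n > 0\<close> by auto
    with drop i(2) show False unfolding distinct_adj_conv_nth by metis
  qed
qed

definition stabilization_coeff :: "nat \<Rightarrow> perm_tuple \<Rightarrow> perm_tuple \<Rightarrow> 'k::comm_ring_1" where
  "stabilization_coeff n \<sigma> \<tau> = of_int (stabilization_sign n \<sigma>) * of_bool (drop (n - 1) \<sigma> = \<tau>)"

lemma stabilization_eq_linear_extension:
  "stabilization n d = linear_extension (nondeg_tuples n (d + int n - 1)) (nondeg_tuples n d)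
     (stabilization_coeff n)"
  by (simp add: stabilization_def stabilization_coeff_def[abs_def])

text \<open>Deleting one of the first \<open>n\<close> entries leaves the tail without its first
  entry; the alternating sum combines these terms into face 0 of the tail. Deleting a later entry
  keeps the leading values and gives another face of the tail. The global sign is the offset
  \<open>n - 1\<close> between the two numberings of faces.\<close>

lemma stabilization_coeff_chain_map:
  assumes n: "n > 0" and \<sigma>: "\<sigma> \<in> nondeg_tuples n (d + int n)" and \<upsilon>: "\<upsilon> \<in> nondeg_tuples n d"
  shows "(\<Sum>\<tau>\<in>nondeg_tuples n (d + int n - 1). face_sum \<sigma> \<tau> * stabilization_coeff n \<tau> \<upsilon>) =
    ((- 1) ^ (n - 1) *
      (\<Sum>\<tau>\<in>nondeg_tuples n (d + 1). stabilization_coeff n \<sigma> \<tau> * face_sum \<tau> \<upsilon>) :: 'k::comm_ring_1)"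
proof -
  obtain m where m: "n = Suc m" using n gr0_implies_Suc by blast
  let ?s = "stabilization_sign n"
  let ?L = "length \<sigma>"
  have d: "d \<ge> 0" and len: "int ?L = d + int n + 1"
    and perm: "\<forall>\<rho>\<in>set \<sigma>. \<rho> permutes {1..n}" and dist: "distinct_adj \<sigma>"
    and dist_\<upsilon>: "distinct_adj \<upsilon>"
    using \<sigma> \<upsilon> by (auto simp: nondeg_tuples_def)
  obtain l where l: "?L = Suc n + l" using d len by (intro that[of "nat d"]) auto
  then have L: "?L = Suc m + Suc l" by (simp add: m)
  have face_coeff: "(if delete_at i \<sigma> \<in> nondeg_tuples n (d + int n - 1)
      then stabilization_coeff n (delete_at i \<sigma>) \<upsilon> else 0) =
      (stabilization_coeff n (delete_at i \<sigma>) \<upsilon> :: 'k)" if i: "i < ?L" for i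
  proof (cases "?s (delete_at i \<sigma>) \<noteq> 0 \<and> drop (n - 1) (delete_at i \<sigma>) = \<upsilon>")
    case True
    then have "distinct_adj (delete_at i \<sigma>)"
      using n dist_\<upsilon> by (auto intro: distinct_adj_of_stabilization)
    then have "delete_at i \<sigma> \<in> nondeg_tuples n (d + int n - 1)"
      using perm set_delete_at[of i \<sigma>] i len d n
      by (auto simp: nondeg_tuples_def length_delete_at)
    then show ?thesis by simp
  next
    case False
    then show ?thesis by (auto simp: stabilization_coeff_def)
  qed
  have low: "(\<Sum>i<Suc m. (- 1) ^ i * stabilization_coeff n (delete_at i \<sigma>) \<upsilon>) =
      ((- 1) ^ m * of_int (?s \<sigma>) * of_bool (drop n \<sigma> = \<upsilon>) :: 'k)"
  proof -
    \<comment> \<open>Deleting the entry at index \<open>n\<close> does not touch the first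
      \<open>n\<close> values. Its term in the alternating sum is therefore known and determines the
      sum of the other \<open>n\<close> terms.\<close>
    have "?s (delete_at n \<sigma>) = ?s \<sigma>"
      unfolding stabilization_sign_eq_sequence_sign[OF n]
      by (rule sequence_sign_cong) (simp add: nth_delete_at l skip_def)
    then have "(\<Sum>i<Suc m. (- 1) ^ i * ?s (delete_at i \<sigma>)) = (- 1) ^ m * ?s \<sigma>"
      using alternating_sum_stabilization_sign[OF n perm] l
      by (simp add: m lessThan_Suc_atMost[symmetric])
    moreover have "(\<Sum>i<Suc m. (- 1) ^ i * stabilization_coeff n (delete_at i \<sigma>) \<upsilon>) =
        (of_int (\<Sum>i<Suc m. (- 1) ^ i * ?s (delete_at i \<sigma>)) * of_bool (drop n \<sigma> = \<upsilon>) :: 'k)"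
      unfolding of_int_sum sum_distrib_right
      by (intro sum.cong) (auto simp: stabilization_coeff_def drop_delete_at_less m l)
    ultimately show ?thesis by simp
  qed
  have high: "stabilization_coeff n (delete_at (Suc m + i) \<sigma>) \<upsilon> =
      (of_int (?s \<sigma>) * of_bool (delete_at (Suc i) (drop m \<sigma>) = \<upsilon>) :: 'k)" if "i < Suc l" for i
  proof -
    have "?s (delete_at (Suc m + i) \<sigma>) = ?s \<sigma>"
      unfolding stabilization_sign_eq_sequence_sign[OF n]
      by (rule sequence_sign_cong) (use that in \<open>simp add: nth_delete_at l m skip_def\<close>)
    moreover have "drop m (delete_at (Suc m + i) \<sigma>) = delete_at (Suc i) (drop m \<sigma>)"
      using drop_delete_at_ge[of m "Suc i" \<sigma>] that by (simp add: l m)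
    ultimately show ?thesis by (simp add: stabilization_coeff_def m)
  qed
  have "(\<Sum>\<tau>\<in>nondeg_tuples n (d + int n - 1). face_sum \<sigma> \<tau> * stabilization_coeff n \<tau> \<upsilon>) =
      (\<Sum>i<Suc m + Suc l. (- 1) ^ i * stabilization_coeff n (delete_at i \<sigma>) \<upsilon> :: 'k)"
    unfolding sum_face_sum[OF finite_nondeg_tuples] L[symmetric]
    by (intro sum.cong refl) (simp only: face_coeff lessThan_iff)
  also have "\<dots> = (\<Sum>i<Suc m. (- 1) ^ i * stabilization_coeff n (delete_at i \<sigma>) \<upsilon>) +
      (\<Sum>i<Suc l. (- 1) ^ (Suc m + i) * stabilization_coeff n (delete_at (Suc m + i) \<sigma>) \<upsilon>)"
    by (induction l) (simp_all add: algebra_simps)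
  also have "(\<Sum>i<Suc l. (- 1) ^ (Suc m + i) * stabilization_coeff n (delete_at (Suc m + i) \<sigma>) \<upsilon>) =
      (- 1) ^ m * of_int (?s \<sigma>) *
        (\<Sum>i<Suc l. (- 1) ^ Suc i * of_bool (delete_at (Suc i) (drop m \<sigma>) = \<upsilon>) :: 'k)"
    unfolding sum_distrib_left by (intro sum.cong refl) (simp add: high[unfolded add_Suc] power_add)
  also have "(\<Sum>i<Suc m. (- 1) ^ i * stabilization_coeff n (delete_at i \<sigma>) \<upsilon>) + \<dots> =
      (- 1) ^ m * (of_int (?s \<sigma>) * face_sum (drop m \<sigma>) \<upsilon>)"
  proof -
    have "length (drop m \<sigma>) = Suc (Suc l)" by (simp add: l m)
    then have "face_sum (drop m \<sigma>) \<upsilon> = of_bool (drop n \<sigma> = \<upsilon>) +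
        (\<Sum>i<Suc l. (- 1) ^ Suc i * of_bool (delete_at (Suc i) (drop m \<sigma>) = \<upsilon>) :: 'k)"
      unfolding face_sum_def by (simp only: sum.lessThan_Suc_shift[of _ "Suc l"])
        (simp add: delete_at_0 tl_drop drop_Suc m)
    then show ?thesis unfolding low by (simp only: distrib_left mult.assoc)
  qed
  also have "of_int (?s \<sigma>) * face_sum (drop m \<sigma>) \<upsilon> =
      (\<Sum>\<tau>\<in>nondeg_tuples n (d + 1). stabilization_coeff n \<sigma> \<tau> * face_sum \<tau> \<upsilon> :: 'k)"
  proof -
    have "distinct_adj (drop m \<sigma>)"
      using dist distinct_adj_appendD2[of "take m \<sigma>" "drop m \<sigma>"] by simp
    then have "drop m \<sigma> \<in> nondeg_tuples n (d + 1)"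
      using perm set_drop_subset[of m \<sigma>] d len by (auto simp: nondeg_tuples_def m)
    moreover have "(\<Sum>\<tau>\<in>nondeg_tuples n (d + 1). stabilization_coeff n \<sigma> \<tau> * face_sum \<tau> \<upsilon>) =
       (\<Sum>\<tau>\<in>nondeg_tuples n (d + 1). if drop m \<sigma> = \<tau> then of_int (?s \<sigma>) * face_sum \<tau> \<upsilon> else 0 :: 'k)"
      by (intro sum.cong) (auto simp: stabilization_coeff_def m)
    ultimately show ?thesis by (simp add: finite_nondeg_tuples)
  qed
  finally show ?thesis by (simp add: m mult.assoc)
qed

section \<open>The stable complexes\<close>

text \<open>The shift at level \<open>k\<close>, and so the degree in which tuples of length one sit
  there.\<close>

definition suspension_degree :: "nat \<Rightarrow> nat \<Rightarrow> int" where
  "suspension_degree n k = int k - int k * int n"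

lemma suspension_degree_Suc: "suspension_degree n (Suc k) = suspension_degree n k + 1 - int n"
  by (simp add: suspension_degree_def algebra_simps)

text \<open>Matches the degree of level \<open>Suc k\<close> with the source degree
  \<open>e + n - 1\<close> of \<open>stabilization n e\<close>.\<close>

lemma diff_suspension_degree_Suc:
  "d - suspension_degree n (Suc k) = d - suspension_degree n k + int n - 1"
  by (simp add: suspension_degree_Suc)

definition suspension_sign :: "nat \<Rightarrow> nat \<Rightarrow> 'k::comm_ring_1" where
  "suspension_sign n k = (if even (suspension_degree n k) then 1 else - 1)"

lemma suspension_sign_square: "suspension_sign n k * (suspension_sign n k * x) = x"
  by (simp add: suspension_sign_def)

text \<open>One level up the shift changes by \<open>1 - n\<close>. The resulting change of sign in
  the differential absorbs the sign in \<open>stabilization_coeff_chain_map\<close>.\<close>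

lemma suspension_sign_Suc:
  "n > 0 \<Longrightarrow> suspension_sign n (Suc k) * (- 1) ^ (n - 1) = suspension_sign n k"
  by (cases n) (auto simp: suspension_sign_def suspension_degree_Suc)

lemma bdry_operadic_suspension:
  "bdry (operadic_suspension k n (barratt_eccles n)) d f =
    (\<lambda>v\<in>nondeg_tuples n (d - suspension_degree n k - 1).
      suspension_sign n k * bdry (barratt_eccles n) (d - suspension_degree n k) f v)"
  by (simp add: operadic_suspension_def shift_def suspension_degree_def[symmetric]
      suspension_sign_def class_ring.func_space_def barratt_eccles_def)

lemma stabilization_chain_map:
  assumes n: "n > 0"
  shows "stabilization n (d - suspension_degree n k)
      (bdry (operadic_suspension (Suc k) n (barratt_eccles n)) (d + 1) y) =
    bdry (operadic_suspension k n (barratt_eccles n)) (d + 1)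
      (stabilization n (d + 1 - suspension_degree n k) y)" (is "?l = ?r")
proof (rule ext)
  fix \<upsilon>
  define e where "e = d - suspension_degree n k"
  have e: "d + 1 - suspension_degree n (Suc k) = e + int n" "d + 1 - suspension_degree n k = e + 1"
    by (simp_all add: e_def suspension_degree_Suc)
  have shift_deg: "e + 1 + int n - 1 = e + int n" by simp
  let ?s = "suspension_sign n"
  show "?l \<upsilon> = ?r \<upsilon>"
  proof (cases "\<upsilon> \<in> nondeg_tuples n e")
    case True
    have "?l \<upsilon> = ?s (Suc k) * (\<Sum>\<tau>\<in>nondeg_tuples n (e + int n - 1).
        linear_extension (nondeg_tuples n (e + int n)) (nondeg_tuples n (e + int n - 1)) face_sum y \<tau>
          * stabilization_coeff n \<tau> \<upsilon>)"
      unfolding bdry_operadic_suspension e e_def[symmetric] stabilization_eq_linear_extension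
      by (simp only: linear_extension_scale bdry_barratt_eccles restrict_apply' True)
        (simp only: linear_extension_apply[OF True])
    also have "\<dots> = ?s (Suc k) * ((- 1) ^ (n - 1) * (\<Sum>\<sigma>\<in>nondeg_tuples n (e + int n). y \<sigma> *
        (\<Sum>\<tau>\<in>nondeg_tuples n (e + 1). stabilization_coeff n \<sigma> \<tau> * face_sum \<tau> \<upsilon>)))"
      unfolding sum_linear_extension[OF finite_nondeg_tuples finite_nondeg_tuples]
      by (simp add: stabilization_coeff_chain_map[OF n _ True] sum_distrib_left mult.left_commute)
    also have "\<dots> = ?s k * (\<Sum>\<tau>\<in>nondeg_tuples n (e + 1).
        stabilization n (e + 1) y \<tau> * face_sum \<tau> \<upsilon>)"
      unfolding stabilization_eq_linear_extension
        sum_linear_extension[OF finite_nondeg_tuples finite_nondeg_tuples]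
      by (simp only: suspension_sign_Suc[OF n] mult.assoc[symmetric] shift_deg)
    also have "\<dots> = ?r \<upsilon>"
      unfolding bdry_operadic_suspension e bdry_barratt_eccles
      using True by (simp add: linear_extension_apply)
    finally show ?thesis .
  next
    case False
    \<comment> \<open>Outside the target basis both sides take the value
      \<open>undefined\<close>.\<close>
    then show ?thesis
      by (simp add: bdry_operadic_suspension e stabilization_eq_linear_extension
          linear_extension_def e_def[symmetric])
  qed
qed

section \<open>Levelwise description of the limit complex\<close>

lemma carrier_stable_barratt_eccles:
  "x \<in> carrier (chain_space (stable_barratt_eccles n) d) \<longleftrightarrow>
    (\<forall>k. x k \<in> nondeg_tuples n (d - suspension_degree n k) \<rightarrow>\<^sub>E UNIV \<and>
      stabilization n (d - suspension_degree n k) (x (Suc k)) = x k)"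
  by (simp add: stable_barratt_eccles_def tower_limit_def operadic_suspension_def shift_def
      barratt_eccles_def class_ring.func_space_def suspension_degree_def)

lemma zero_stable_barratt_eccles:
  "\<zero>\<^bsub>chain_space (stable_barratt_eccles n) d\<^esub> =
    (\<lambda>k. \<lambda>v\<in>nondeg_tuples n (d - suspension_degree n k). 0)"
  by (simp add: stable_barratt_eccles_def tower_limit_def operadic_suspension_def shift_def
      barratt_eccles_def class_ring.func_space_def suspension_degree_def)

lemma add_stable_barratt_eccles:
  "x \<oplus>\<^bsub>chain_space (stable_barratt_eccles n) d\<^esub> y =
    (\<lambda>k. \<lambda>v\<in>nondeg_tuples n (d - suspension_degree n k). x k v + y k v)"
  by (simp add: stable_barratt_eccles_def tower_limit_def operadic_suspension_def shift_def
      barratt_eccles_def class_ring.func_space_def suspension_degree_def)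

lemma smult_stable_barratt_eccles:
  "c \<odot>\<^bsub>chain_space (stable_barratt_eccles n) d\<^esub> x =
    (\<lambda>k. \<lambda>v\<in>nondeg_tuples n (d - suspension_degree n k). c * x k v)"
  by (simp add: stable_barratt_eccles_def tower_limit_def operadic_suspension_def shift_def
      barratt_eccles_def class_ring.func_space_def suspension_degree_def)

lemma bdry_stable_barratt_eccles:
  "bdry (stable_barratt_eccles n) d x =
    (\<lambda>k. bdry (operadic_suspension k n (barratt_eccles n)) d (x k))"
  by (simp add: stable_barratt_eccles_def tower_limit_def)

lemmas stable_barratt_eccles_simps =
  carrier_stable_barratt_eccles zero_stable_barratt_eccles add_stable_barratt_eccles
  smult_stable_barratt_eccles bdry_stable_barratt_eccles

lemma stable_carrier_smult:
  assumes "x \<in> carrier (chain_space (stable_barratt_eccles n) d)"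
  shows "c \<odot>\<^bsub>chain_space (stable_barratt_eccles n) d\<^esub> x \<in>
    carrier (chain_space (stable_barratt_eccles n) d)"
  using assms unfolding stable_barratt_eccles_simps diff_suspension_degree_Suc
  by (simp add: stabilization_eq_linear_extension linear_extension_scale)

lemma stable_carrier_add:
  assumes "x \<in> carrier (chain_space (stable_barratt_eccles n) d)"
    "y \<in> carrier (chain_space (stable_barratt_eccles n) d)"
  shows "x \<oplus>\<^bsub>chain_space (stable_barratt_eccles n) d\<^esub> y \<in>
    carrier (chain_space (stable_barratt_eccles n) d)"
  using assms unfolding stable_barratt_eccles_simps diff_suspension_degree_Suc
  by (simp add: stabilization_eq_linear_extension linear_extension_add)

lemma stable_carrier_zero:
  "\<zero>\<^bsub>chain_space (stable_barratt_eccles n) d\<^esub> \<in> carrier (chain_space (stable_barratt_eccles n) d)"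
  unfolding stable_barratt_eccles_simps diff_suspension_degree_Suc
  by (auto simp: stabilization_eq_linear_extension intro!: linear_extension_eqI)

lemma bdry_stable_zero:
  "bdry (stable_barratt_eccles n) d \<zero>\<^bsub>chain_space (stable_barratt_eccles n) d\<^esub> =
    \<zero>\<^bsub>chain_space (stable_barratt_eccles n) (d - 1)\<^esub>"
  by (auto simp: stable_barratt_eccles_simps bdry_operadic_suspension bdry_barratt_eccles
      linear_extension_apply algebra_simps intro!: ext)

lemma bdry_stable_add:
  "bdry (stable_barratt_eccles n) (d + 1) (x \<oplus>\<^bsub>chain_space (stable_barratt_eccles n) (d + 1)\<^esub> y) =
    bdry (stable_barratt_eccles n) (d + 1) x \<oplus>\<^bsub>chain_space (stable_barratt_eccles n) d\<^esub>
      bdry (stable_barratt_eccles n) (d + 1) y"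
  by (auto simp: stable_barratt_eccles_simps bdry_operadic_suspension bdry_barratt_eccles
      linear_extension_add ring_distribs intro!: ext)

section \<open>Homology of the limit from exactness\<close>

lemma carrier_subquotient_singleton:
  assumes "Z \<noteq> {}" "\<And>z. z \<in> Z \<Longrightarrow> B +>\<^bsub>M\<^esub> z = B"
  shows "carrier (subquotient M Z B) = {B}"
  using assms by (auto simp: subquotient_def)

lemma zero_module_iso:
  assumes "carrier M = {b}"
  shows "\<exists>f \<in> module_hom R M zero_module. bij_betw f (carrier M) (carrier zero_module)"
  using assms
  by (intro bexI[of _ "\<lambda>_. 0"])
    (auto simp: module_hom_def zero_module_def regular_module_def bij_betw_def)

text \<open>As \<open>b\<close> is neutral, the cosets are singletons, which \<open>the_elem\<close>
  unwraps. Neutrality also removes the \<open>b\<close> that scaling a coset adds back.\<close>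

lemma subquotient_iso_of_trivial_boundaries:
  assumes zero: "\<And>z. z \<in> carrier M \<Longrightarrow> b \<oplus>\<^bsub>M\<^esub> z = z"
    and add: "\<And>x y. x \<in> carrier M \<Longrightarrow> y \<in> carrier M \<Longrightarrow> x \<oplus>\<^bsub>M\<^esub> y \<in> carrier M"
    and smult: "\<And>c x. x \<in> carrier M \<Longrightarrow> c \<odot>\<^bsub>M\<^esub> x \<in> carrier M"
    and f: "f \<in> module_hom R M N" "bij_betw f (carrier M) (carrier N)"
  shows "\<exists>g \<in> module_hom R (subquotient M (carrier M) {b}) N.
    bij_betw g (carrier (subquotient M (carrier M) {b})) (carrier N)"
proof
  let ?Q = "subquotient M (carrier M) {b}"
  have carrier: "carrier ?Q = (\<lambda>z. {z}) ` carrier M"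
    using zero by (auto simp: subquotient_def a_r_coset_def' intro!: image_cong)
  have "{x} <+>\<^bsub>M\<^esub> {y} = {x \<oplus>\<^bsub>M\<^esub> y}" for x y
    by (auto simp: set_add_def')
  then have ops: "{x} \<oplus>\<^bsub>?Q\<^esub> {y} = {x \<oplus>\<^bsub>M\<^esub> y}" "c \<odot>\<^bsub>?Q\<^esub> {x} = {b \<oplus>\<^bsub>M\<^esub> (c \<odot>\<^bsub>M\<^esub> x)}" for x y c
    by (simp_all add: subquotient_def)
  show "f \<circ> the_elem \<in> module_hom R ?Q N"
    using f(1) zero smult by (auto simp: module_hom_def carrier ops)
  have "bij_betw the_elem (carrier ?Q) (carrier M)"
    unfolding carrier by (rule bij_betw_byWitness[where f' = "\<lambda>z. {z}"]) auto
  then show "bij_betw (f \<circ> the_elem) (carrier ?Q) (carrier N)"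
    using f(2) by (rule bij_betw_trans)
qed

text \<open>Each cycle is the boundary of some \<open>y\<close>, and its coset consists of the
  boundaries of the translates \<open>x + y\<close>. Translation by \<open>y\<close> maps the chains
  onto themselves, so the coset is the set of all boundaries.\<close>

lemma carrier_homology_stable_singleton:
  assumes exact: "\<And>z. z \<in> carrier (chain_space (stable_barratt_eccles n) d) \<Longrightarrow>
      bdry (stable_barratt_eccles n) d z = \<zero>\<^bsub>chain_space (stable_barratt_eccles n) (d - 1)\<^esub> \<Longrightarrow>
      \<exists>y \<in> carrier (chain_space (stable_barratt_eccles n) (d + 1)).
        bdry (stable_barratt_eccles n) (d + 1) y = (z :: nat \<Rightarrow> perm_tuple \<Rightarrow> 'k::comm_ring_1)"
  shows "\<exists>b. carrier (homology (stable_barratt_eccles n ::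
      ('k, nat \<Rightarrow> perm_tuple \<Rightarrow> 'k) chain_complex) d) = {b}"
proof -
  let ?X = "stable_barratt_eccles n :: ('k, nat \<Rightarrow> perm_tuple \<Rightarrow> 'k) chain_complex"
  let ?C = "carrier (chain_space ?X (d + 1))"
  let ?M = "chain_space ?X (d + 1)"
  let ?B = "bdry ?X (d + 1) ` ?C"
  let ?Z = "{z \<in> carrier (chain_space ?X d). bdry ?X d z = \<zero>\<^bsub>chain_space ?X (d - 1)\<^esub>}"
  have "?B +>\<^bsub>chain_space ?X d\<^esub> z = ?B" if z_in: "z \<in> ?Z" for z
  proof -
    obtain y where y: "y \<in> ?C" and z: "z = bdry ?X (d + 1) y"
      using exact z_in by blast
    have "?B +>\<^bsub>chain_space ?X d\<^esub> z = (\<lambda>x. bdry ?X (d + 1) (x \<oplus>\<^bsub>?M\<^esub> y)) ` ?C"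
      by (auto simp: a_r_coset_def' z bdry_stable_add)
    also have "\<dots> = bdry ?X (d + 1) ` (\<lambda>x. x \<oplus>\<^bsub>?M\<^esub> y) ` ?C"
      by (simp add: image_image)
    also have "(\<lambda>x. x \<oplus>\<^bsub>?M\<^esub> y) ` ?C = ?C"
    proof (intro equalityI subsetI)
      fix x assume x: "x \<in> ?C"
      \<comment> \<open>The preimage \<open>x - y\<close> of \<open>x\<close>, with the difference
        expressed through scaling by -1. Adding \<open>y\<close> back gives \<open>x\<close> exactly
        because \<open>x\<close> is extensional at each level.\<close>
      let ?x = "x \<oplus>\<^bsub>?M\<^esub> ((- 1) \<odot>\<^bsub>?M\<^esub> y)"
      have "x k \<in> nondeg_tuples n (d + 1 - suspension_degree n k) \<rightarrow>\<^sub>E UNIV" for k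
        using x by (simp add: carrier_stable_barratt_eccles)
      then have "?x \<oplus>\<^bsub>?M\<^esub> y = x"
        by (auto simp: add_stable_barratt_eccles smult_stable_barratt_eccles PiE_def extensional_def
            fun_eq_iff)
      moreover have "?x \<in> ?C"
        by (intro stable_carrier_add stable_carrier_smult x y)
      ultimately show "x \<in> (\<lambda>x. x \<oplus>\<^bsub>?M\<^esub> y) ` ?C" by (metis image_eqI)
    qed (use y stable_carrier_add in auto)
    finally show ?thesis .
  qed
  moreover have "\<zero>\<^bsub>chain_space ?X d\<^esub> \<in> ?Z"
    by (simp add: stable_carrier_zero bdry_stable_zero)
  ultimately have "carrier (subquotient (chain_space ?X d) ?Z ?B) = {?B}"
    by (intro carrier_subquotient_singleton) auto
  then show ?thesis unfolding homology_def by blast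
qed

lemma stable_zero_exact:
  "\<exists>y \<in> carrier (chain_space (stable_barratt_eccles n) (d + 1)).
    bdry (stable_barratt_eccles n) (d + 1) y = \<zero>\<^bsub>chain_space (stable_barratt_eccles n) d\<^esub>"
  using bdry_stable_zero[of n "d + 1"] by (intro bexI[OF _ stable_carrier_zero]) simp

lemma stable_exact:
  fixes z :: "nat \<Rightarrow> perm_tuple \<Rightarrow> 'k::{comm_ring_1, finite}"
  assumes n: "n \<ge> 2" and z: "z \<in> carrier (chain_space (stable_barratt_eccles n) d)"
    and cycle: "bdry (stable_barratt_eccles n) d z = \<zero>\<^bsub>chain_space (stable_barratt_eccles n) (d - 1)\<^esub>"
  shows "\<exists>y \<in> carrier (chain_space (stable_barratt_eccles n) (d + 1)).
    bdry (stable_barratt_eccles n) (d + 1) y = z"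
proof -
  let ?m = "suspension_degree n"
  let ?D = "\<lambda>k. bdry (operadic_suspension k n (barratt_eccles n)) ::
    int \<Rightarrow> (perm_tuple \<Rightarrow> 'k) \<Rightarrow> (perm_tuple \<Rightarrow> 'k)"
  have z_in: "z k \<in> nondeg_tuples n (d - ?m k) \<rightarrow>\<^sub>E UNIV"
    and z_lim: "stabilization n (d - ?m k) (z (Suc k)) = z k" for k
    using z by (auto simp: carrier_stable_barratt_eccles)
  \<comment> \<open>The primitives of \<open>z k\<close> at level \<open>k\<close>; a point of the
    inverse limit of these sets is a primitive of \<open>z\<close>.\<close>
  define S where "S k = {y \<in> nondeg_tuples n (d + 1 - ?m k) \<rightarrow>\<^sub>E UNIV. ?D k (d + 1) y = z k}" for k
  have maps: "stabilization n (d + 1 - ?m k) y \<in> S k" if "y \<in> S (Suc k)" for k y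
    using that n stabilization_chain_map[of n d k y] z_lim[of k]
    by (auto simp: S_def stabilization_eq_linear_extension linear_extension_in)
  have "S k \<noteq> {}" if pos: "d - ?m k > 0" for k
  proof -
    let ?s = "suspension_sign n k :: 'k"
    have "d - 1 - ?m k = d - ?m k - 1" by simp
    with fun_cong[OF cycle, of k] have level_cycle: "?D k d (z k) = (\<lambda>v\<in>nondeg_tuples n (d - ?m k - 1). 0)"
      by (simp only: bdry_stable_barratt_eccles zero_stable_barratt_eccles)
    have "?s * bdry (barratt_eccles n) (d - ?m k) (z k) v = 0"
      if "v \<in> nondeg_tuples n (d - ?m k - 1)" for v
      using that fun_cong[OF level_cycle, of v] by (simp add: bdry_operadic_suspension)
    then have "bdry (barratt_eccles n) (d - ?m k) (z k) v = 0"
      if "v \<in> nondeg_tuples n (d - ?m k - 1)" for v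
      using that suspension_sign_square by (metis mult_zero_right)
    then have "bdry (barratt_eccles n) (d - ?m k) (z k) = (\<lambda>v\<in>nondeg_tuples n (d - ?m k - 1). 0)"
      by (auto simp: bdry_barratt_eccles linear_extension_def fun_eq_iff)
    from barratt_eccles_acyclic[OF pos z_in this] obtain y
      where y: "y \<in> nondeg_tuples n (d - ?m k + 1) \<rightarrow>\<^sub>E UNIV"
        and yz: "bdry (barratt_eccles n) (d - ?m k + 1) y = z k" .
    have deg: "d + 1 - ?m k = d - ?m k + 1" by simp
    \<comment> \<open>The suspended differential carries the sign \<open>?s\<close>, so the
      primitive is multiplied by \<open>?s\<close> too and the signs square to 1.\<close>
    have "?D k (d + 1) (\<lambda>v\<in>nondeg_tuples n (d - ?m k + 1). ?s * y v) = z k"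
      unfolding bdry_operadic_suspension deg bdry_barratt_eccles linear_extension_scale
      using yz z_in[of k]
      by (auto simp: bdry_barratt_eccles suspension_sign_square fun_eq_iff PiE_def extensional_def)
    then have "(\<lambda>v\<in>nondeg_tuples n (d - ?m k + 1). ?s * y v) \<in> S k"
      by (simp add: S_def deg)
    then show ?thesis by blast
  qed
  moreover have "d - ?m j > 0" if "int j \<ge> 1 - d" for j
  proof -
    \<comment> \<open>Since \<open>n \<ge> 2\<close>, level \<open>j\<close> is shifted down by at
      least \<open>j\<close>; from \<open>j \<ge> 1 - d\<close> on, degree \<open>d\<close> lies
      strictly above the homology of that level.\<close>
    have "int j * 1 \<le> int j * (int n - 1)" using n by (intro mult_left_mono) auto
    moreover have "?m j = - (int j * (int n - 1))" by (simp add: suspension_degree_def algebra_simps)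
    ultimately show ?thesis using that by linarith
  qed
  ultimately have large: "S (k + nat (1 - d)) \<noteq> {}" for k by simp
  \<comment> \<open>Nonemptiness descends along the tower maps from high levels to all
    levels.\<close>
  have "S k \<noteq> {}" if "S (k + j) \<noteq> {}" for k j
    using that by (induction j) (use maps in fastforce)+
  with large have ne: "S k \<noteq> {}" for k by blast
  \<comment> \<open>Finiteness of the coefficients enters here: only finitely many functions exist
    on the finite set of tuples.\<close>
  have fin: "finite (S k)" for k
    unfolding S_def by (rule finite_subset[OF _ finite_PiE[OF finite_nondeg_tuples]]) auto
  obtain y where "\<forall>k. y k \<in> S k \<and> stabilization n (d + 1 - ?m k) (y (Suc k)) = y k"
    using inverse_limit_finite_nonempty[of S "\<lambda>k. stabilization n (d + 1 - ?m k)", OF fin ne maps] by blast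
  then show ?thesis
    by (intro bexI[of _ y])
      (auto simp: S_def carrier_stable_barratt_eccles bdry_stable_barratt_eccles)
qed

section \<open>Arities 0 and 1, and passage to cochains\<close>

lemma carrier_stable_0:
  "carrier (chain_space (stable_barratt_eccles 0) d) \<subseteq> {\<zero>\<^bsub>chain_space (stable_barratt_eccles 0) d\<^esub>}"
proof
  fix x :: "nat \<Rightarrow> perm_tuple \<Rightarrow> 'a"
  assume "x \<in> carrier (chain_space (stable_barratt_eccles 0) d)"
  \<comment> \<open>Every component of a point of the limit is a value of the stabilization map,
    which is zero in arity 0.\<close>
  then have "x k = stabilization 0 (d - suspension_degree 0 k) (x (Suc k))" for k
    by (simp add: carrier_stable_barratt_eccles)
  then have "x k = (\<lambda>v\<in>nondeg_tuples 0 (d - suspension_degree 0 k). 0)" for k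
    by (simp add: stabilization_def stabilization_sign_def linear_extension_def)
  then show "x \<in> {\<zero>\<^bsub>chain_space (stable_barratt_eccles 0) d\<^esub>}"
    by (simp add: zero_stable_barratt_eccles fun_eq_iff)
qed

lemma nondeg_tuples_1: "nondeg_tuples 1 d = (if d = 0 then {[id]} else {})"
proof -
  have "\<sigma> = [id]" if "\<sigma> \<in> nondeg_tuples 1 d" for \<sigma>
  proof -
    have id: "\<rho> = id" if "\<rho> \<in> set \<sigma>" for \<rho>
      using \<open>\<sigma> \<in> _\<close> that by (auto simp: nondeg_tuples_def)
    show ?thesis
    \<comment> \<open>The rule separates lists of length 0, 1 and at least 2; in the last case two
      neighbours would both be the identity.\<close>
    proof (cases \<sigma> rule: remdups_adj.cases)
      case (3 \<rho> \<rho>' \<sigma>')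
      then show ?thesis using that id by (auto simp: nondeg_tuples_def)
    qed (use that id in \<open>auto simp: nondeg_tuples_def\<close>)
  qed
  moreover have "[id] \<in> nondeg_tuples 1 d \<longleftrightarrow> d = 0"
    by (auto simp: nondeg_tuples_def)
  ultimately show ?thesis by auto
qed

lemma suspension_degree_1 [simp]: "suspension_degree 1 k = 0"
  by (simp add: suspension_degree_def)

lemma carrier_stable_1:
  "d \<noteq> 0 \<Longrightarrow> carrier (chain_space (stable_barratt_eccles 1) d) \<subseteq>
    {\<zero>\<^bsub>chain_space (stable_barratt_eccles 1) d\<^esub>}"
  by (auto simp: carrier_stable_barratt_eccles zero_stable_barratt_eccles nondeg_tuples_1
      restrict_def simp del: One_nat_def)

lemma stabilization_1: "stabilization 1 0 f = restrict f {[id]}"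
proof -
  have "leading_values 1 [id] = id"
    by (auto simp: leading_values_def fun_eq_iff)
  then have "stabilization_sign 1 [id] = 1"
    by (simp add: stabilization_sign_def)
  then show ?thesis
    by (simp add: stabilization_def linear_extension_def nondeg_tuples_1 fun_eq_iff
        del: One_nat_def)
qed

text \<open>The tower maps are the identity on functions supported on \<open>{[id]}\<close>, so its
  limit consists of the constant sequences.\<close>

lemma carrier_stable_1_0:
  "carrier (chain_space (stable_barratt_eccles 1) 0) = (\<lambda>f k. f) ` ({[id]} \<rightarrow>\<^sub>E UNIV)"
proof (intro equalityI subsetI)
  fix x :: "nat \<Rightarrow> perm_tuple \<Rightarrow> 'a" assume "x \<in> carrier (chain_space (stable_barratt_eccles 1) 0)"
  then have x: "x k \<in> {[id]} \<rightarrow>\<^sub>E UNIV" "restrict (x (Suc k)) {[id]} = x k" for k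
    by (simp_all add: carrier_stable_barratt_eccles nondeg_tuples_1 stabilization_1 del: One_nat_def)
  then have "x (Suc k) = x k" for k by (metis PiE_restrict)
  then have "x k = x 0" for k by (induction k) simp_all
  then have "x = (\<lambda>k. x 0)" by blast
  with x(1)[of 0] show "x \<in> (\<lambda>f k. f) ` ({[id]} \<rightarrow>\<^sub>E UNIV)" by blast
qed (auto simp: carrier_stable_barratt_eccles nondeg_tuples_1 stabilization_1 simp del: One_nat_def)

text \<open>Reindexing leaves the sets of cycles and boundaries as they are, so the modules are
  equal and not merely isomorphic.\<close>

lemma cohomology_dagger: "cohomology (dagger X) d = homology X (- d)"
proof -
  have "- (d + 1) = - d - 1" "- (d - 1) = - d + 1" by simp_all
  then show ?thesis by (simp only: cohomology_def homology_def dagger_def cochain_complex.simps)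
qed

lemma homology_stable_1_0:
  "\<exists>f \<in> module_hom class_ring (homology (stable_barratt_eccles 1 ::
      ('k::comm_ring_1, nat \<Rightarrow> perm_tuple \<Rightarrow> 'k) chain_complex) 0) regular_module.
    bij_betw f (carrier (homology (stable_barratt_eccles 1 ::
      ('k, nat \<Rightarrow> perm_tuple \<Rightarrow> 'k) chain_complex) 0)) (carrier regular_module)"
proof -
  let ?X = "stable_barratt_eccles 1 :: ('k, nat \<Rightarrow> perm_tuple \<Rightarrow> 'k) chain_complex"
  let ?M = "chain_space ?X 0"
  \<comment> \<open>The isomorphism reads off the coefficient of \<open>[id]\<close> at level 0,
    which determines a constant sequence.\<close>
  let ?f = "\<lambda>x. x 0 [id] :: 'k"
  have "carrier (chain_space ?X 1) = {\<zero>\<^bsub>chain_space ?X 1\<^esub>}"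
    using carrier_stable_1[of 1] stable_carrier_zero[of 1 1] by auto
  then have "bdry ?X 1 ` carrier (chain_space ?X 1) = {\<zero>\<^bsub>?M\<^esub>}"
    using bdry_stable_zero[of 1 1] by simp
  \<comment> \<open>There are no tuples in degree -1, so both sides are the \<open>undefined\<close>
    function at every level.\<close>
  moreover have "bdry ?X 0 z = \<zero>\<^bsub>chain_space ?X (- 1)\<^esub>" for z
    by (simp add: bdry_stable_barratt_eccles zero_stable_barratt_eccles bdry_operadic_suspension
        nondeg_tuples_1 restrict_def del: One_nat_def)
  ultimately have H: "homology ?X 0 = subquotient ?M (carrier ?M) {\<zero>\<^bsub>?M\<^esub>}"
    by (simp add: homology_def)
  show ?thesis
    unfolding H
  proof (rule subquotient_iso_of_trivial_boundaries)
    fix z assume "z \<in> carrier ?M"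
    then show "\<zero>\<^bsub>?M\<^esub> \<oplus>\<^bsub>?M\<^esub> z = z"
      by (auto simp: carrier_stable_1_0 add_stable_barratt_eccles zero_stable_barratt_eccles
          nondeg_tuples_1 fun_eq_iff PiE_def extensional_def simp del: One_nat_def)
  next
    show "?f \<in> module_hom class_ring ?M regular_module"
      by (auto simp: module_hom_def regular_module_def add_stable_barratt_eccles
          smult_stable_barratt_eccles nondeg_tuples_1 simp del: One_nat_def)
    show "bij_betw ?f (carrier ?M) (carrier regular_module)"
      unfolding carrier_stable_1_0 regular_module_def
      by (rule bij_betw_byWitness[where f' = "\<lambda>c k. \<lambda>v\<in>{[id]}. c"])
        (auto simp: fun_eq_iff PiE_def extensional_def)
  qed (auto intro: stable_carrier_add stable_carrier_smult)
qed

section \<open>Assembly of the cases\<close>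

lemma homology_stable_iso:
  "graded_iso class_ring
    (homology (stable_barratt_eccles n ::
      ('k::{comm_ring_1, finite}, nat \<Rightarrow> perm_tuple \<Rightarrow> 'k) chain_complex))
    (if n \<noteq> 1 then zero_graded else ground_graded)"
  unfolding graded_iso_def
proof
  fix d
  let ?X = "stable_barratt_eccles n :: ('k, nat \<Rightarrow> perm_tuple \<Rightarrow> 'k) chain_complex"
  let ?N = "(if n \<noteq> 1 then zero_graded else ground_graded) d"
  show "\<exists>f \<in> module_hom class_ring (homology ?X d) ?N.
    bij_betw f (carrier (homology ?X d)) (carrier ?N)"
  proof (cases "n = 1 \<and> d = 0")
    case True
    then show ?thesis using homology_stable_1_0 by (simp add: ground_graded_def)
  next
    case False
    have exact: "\<exists>y \<in> carrier (chain_space ?X (d + 1)). bdry ?X (d + 1) y = z"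
      if "z \<in> carrier (chain_space ?X d)" "bdry ?X d z = \<zero>\<^bsub>chain_space ?X (d - 1)\<^esub>" for z
    proof (cases "n \<ge> 2")
      case True
      then show ?thesis using that by (rule stable_exact)
    next
      case False
      \<comment> \<open>In the remaining cases the only chain in degree \<open>d\<close> is zero,
        which is the boundary of zero.\<close>
      with \<open>\<not> (n = 1 \<and> d = 0)\<close> have "n = 0 \<or> n = 1 \<and> d \<noteq> 0" by auto
      then show ?thesis
        using that(1) carrier_stable_0 carrier_stable_1 stable_zero_exact by blast
    qed
    obtain b where "carrier (homology ?X d) = {b}"
      using carrier_homology_stable_singleton[OF exact] by blast
    moreover have N: "?N = zero_module"
      using False by (auto simp: zero_graded_def ground_graded_def)
    ultimately show ?thesis
      unfolding N by (intro zero_module_iso)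
  qed
qed

theorem proposition2p33:
  fixes n :: nat
  shows "graded_iso class_ring
           (homology (stable_barratt_eccles n ::
             ('p::prime_card mod_ring, nat \<Rightarrow> perm_tuple \<Rightarrow> 'p mod_ring) chain_complex))
           (if n \<noteq> 1 then zero_graded else ground_graded)
       \<and> graded_iso class_ring
           (cohomology (stable_barratt_eccles_dagger n ::
             ('p mod_ring, nat \<Rightarrow> perm_tuple \<Rightarrow> 'p mod_ring) cochain_complex))
           (if n \<noteq> 1 then zero_graded else ground_graded)"
proof
  let ?X = "stable_barratt_eccles n :: ('p mod_ring, nat \<Rightarrow> perm_tuple \<Rightarrow> 'p mod_ring) chain_complex"
  let ?N = "if n \<noteq> 1 then zero_graded else ground_graded :: int \<Rightarrow> ('p mod_ring, 'p mod_ring) module"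
  show iso: "graded_iso class_ring (homology ?X) ?N"
    by (rule homology_stable_iso)
  \<comment> \<open>The target is symmetric under negation of degrees, so the homology statement in
    degree \<open>- d\<close> gives the cohomology statement in degree \<open>d\<close>.\<close>
  have "?N (- d) = ?N d" for d
    by (auto simp: zero_graded_def ground_graded_def)
  with iso show "graded_iso class_ring (cohomology (stable_barratt_eccles_dagger n)) ?N"
    unfolding graded_iso_def stable_barratt_eccles_dagger_def cohomology_dagger by metis
qed

end
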